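(* Let $\Lambda$ be a subgroup of $((0,+\infty),\cdot)$, let $\Gamma\subset\mathbb{R}$ be a $\mathbb{Z}\cdot\Lambda$-submodule that is countable and dense in $\mathbb{R}$, and let $\ell\in\Gamma$ with $\ell>0$. Then the partial action $\beta$ of $\Gamma\ltimes\Lambda$ on $[0_+,\ell_-]$ is expansive: for a metric $d$ compatible with the topology of $[0_+,\ell_-]$ there exists $\epsilon>0$ such that for all $x\ne y$ in $[0_+,\ell_-]$ there exists $g\in\Gamma\ltimes\Lambda$ with $gx,gy\in[0_+,\ell_-]$ and $d(gx,gy)>\epsilon$.
   Context: $\mathbb{Z}\cdot\Lambda$ is the subring of $\mathbb{R}$ generated by $\Lambda$; a $\mathbb{Z}\cdot\Lambda$-submodule of $\mathbb{R}$ is an additive subgroup $\Gamma$ with $\Lambda\cdot\Gamma=\Gamma$. $\Gamma\ltimes\Lambda$ is the group on the set $\Gamma\times\Lambda$ with product $(a,\mu)(b,\lambda)=(\lambda^{-1}a+b,\mu\lambda)$. $\mathbb{R}_\Gamma=(\mathbb{R}\setminus\Gamma)\sqcup\{a_+,a_-: a\in\Gamma\}$, with $q:\mathbb{R}_\Gamma\to\mathbb{R}$, $q(t)=t$, $q(a_\pm)=a$, is totally ordered by: $q(x)<q(y)\Rightarrow x<y$, and $a_-<a_+$ for $a\in\Gamma$; it carries the order topology. $[0_+,\ell_-]=\{x\in\mathbb{R}_\Gamma:0_+\le x\le\ell_-\}$ (a Cantor space). $\beta$ is the restriction to $[0_+,\ell_-]$ of the action on $\mathbb{R}_\Gamma$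 given by $(c,\mu)(t)=\mu(t+c)$ for $t\in\mathbb{R}\setminus\Gamma$ and $(c,\mu)(a_\pm)=(\mu(a+c))_\pm$ for $a\in\Gamma$. *)

theory Defs
  imports "HOL-Analysis.Analysis" "HOL-Algebra.Group"
begin

section \<open>The groups\<close>

definition pos_real_group :: "real monoid" where
  "pos_real_group = \<lparr>carrier = {0<..}, mult = (*), one = 1\<rparr>"

definition add_real_group :: "real monoid" where
  "add_real_group = \<lparr>carrier = UNIV, mult = (+), one = 0\<rparr>"

definition scale_submodule :: "real set \<Rightarrow> real set \<Rightarrow> bool" where
  "scale_submodule \<Lambda> \<Gamma> \<longleftrightarrow>
     subgroup \<Gamma> add_real_group \<and> {\<mu> * a | \<mu> a. \<mu> \<in> \<Lambda> \<and> a \<in> \<Gamma>} = \<Gamma>"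

definition semidirect :: "real set \<Rightarrow> real set \<Rightarrow> (real \<times> real) monoid" where
  "semidirect \<Gamma> \<Lambda> =
     \<lparr>carrier = \<Gamma> \<times> \<Lambda>,
      mult = (\<lambda>(a, \<mu>) (b, \<nu>). (inverse \<nu> * a + b, \<mu> * \<nu>)),
      one = (0, 1)\<rparr>"

lemma group_semidirect:
  assumes L: "subgroup \<Lambda> pos_real_group" and G: "scale_submodule \<Lambda> \<Gamma>"
  shows "group (semidirect \<Gamma> \<Lambda>)"
proof -
  have grpL: "group pos_real_group"
    by (rule groupI) (auto simp: pos_real_group_def intro!: exI[of _ "inverse _"] bexI[of _ "inverse _"])
  have grpR: "group add_real_group"
    by (rule groupI) (auto simp: add_real_group_def intro: exI[of _ "- _"])
  have pos: "\<mu> > 0" if "\<mu> \<in> \<Lambda>" for \<mu>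
    using subgroup.subset[OF L] that by (auto simp: pos_real_group_def)
  have L1: "1 \<in> \<Lambda>" and Lm: "\<And>x y. x \<in> \<Lambda> \<Longrightarrow> y \<in> \<Lambda> \<Longrightarrow> x * y \<in> \<Lambda>"
    using subgroup.one_closed[OF L] subgroup.m_closed[OF L] by (auto simp: pos_real_group_def)
  have Li: "inverse x \<in> \<Lambda>" if "x \<in> \<Lambda>" for x
  proof -
    have "inv\<^bsub>pos_real_group\<^esub> x = inverse x"
      using pos[OF that] by (intro group.inv_equality[OF grpL]) (auto simp: pos_real_group_def)
    then show ?thesis using subgroup.m_inv_closed[OF L that] by simp
  qed
  have S: "subgroup \<Gamma> add_real_group" and
       act: "\<And>x a. x \<in> \<Lambda> \<Longrightarrow> a \<in> \<Gamma> \<Longrightarrow> x * a \<in> \<Gamma>"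
    using G unfolding scale_submodule_def by blast+
  have act': "\<And>x a. x \<in> \<Lambda> \<Longrightarrow> a \<in> \<Gamma> \<Longrightarrow> a * x \<in> \<Gamma>"
    using act by (simp add: mult.commute)
  have G0: "0 \<in> \<Gamma>" and Ga: "\<And>x y. x \<in> \<Gamma> \<Longrightarrow> y \<in> \<Gamma> \<Longrightarrow> x + y \<in> \<Gamma>"
    using subgroup.one_closed[OF S] subgroup.m_closed[OF S] by (auto simp: add_real_group_def)
  have Gi: "- x \<in> \<Gamma>" if "x \<in> \<Gamma>" for x
  proof -
    have "inv\<^bsub>add_real_group\<^esub> x = - x"
      by (intro group.inv_equality[OF grpR]) (auto simp: add_real_group_def)
    then show ?thesis using subgroup.m_inv_closed[OF S that] by simp
  qed
  show ?thesis
  proof (rule groupI)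
    fix g assume "g \<in> carrier (semidirect \<Gamma> \<Lambda>)"
    then obtain a \<mu> where g: "g = (a, \<mu>)" "a \<in> \<Gamma>" "\<mu> \<in> \<Lambda>"
      by (auto simp: semidirect_def)
    show "\<exists>h\<in>carrier (semidirect \<Gamma> \<Lambda>). h \<otimes>\<^bsub>semidirect \<Gamma> \<Lambda>\<^esub> g = \<one>\<^bsub>semidirect \<Gamma> \<Lambda>\<^esub>"
      using g pos[OF g(3)] Li act Gi
      by (intro bexI[of _ "(- (\<mu> * a), inverse \<mu>)"]) (auto simp: semidirect_def)
  qed (use L1 G0 in \<open>auto simp: semidirect_def algebra_simps Lm Ga act act' Li inverse_mult_distrib\<close>)
qed


section \<open>The line with the points of \<open>\<Gamma>\<close> split in two\<close>

text \<open>
  The type is independent of \<open>\<Gamma>\<close>: \<open>Reg t\<close> stands for the unsplit point \<open>t\<close>, and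
  \<open>Minus a\<close>, \<open>Plus a\<close> for \<open>a\<^sub>-\<close>, \<open>a\<^sub>+\<close>. The space \<open>\<real>\<^sub>\<Gamma>\<close> is the subset
  \<open>split_line \<Gamma>\<close>, on which the order below is total; on the whole type it is only partial.
\<close>

datatype split_real = Reg real | Minus real | Plus real

fun proj :: "split_real \<Rightarrow> real" where
  "proj (Reg t) = t"
| "proj (Minus a) = a"
| "proj (Plus a) = a"

definition split_line :: "real set \<Rightarrow> split_real set" where
  "split_line \<Gamma> = Reg ` (- \<Gamma>) \<union> Minus ` \<Gamma> \<union> Plus ` \<Gamma>"

instantiation split_real :: order
begin

definition less_split_real :: "split_real \<Rightarrow> split_real \<Rightarrow> bool" where
  "x < y \<longleftrightarrow> proj x < proj y \<or> (\<exists>a. x = Minus a \<and> y = Plus a)"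

definition less_eq_split_real :: "split_real \<Rightarrow> split_real \<Rightarrow> bool" where
  "x \<le> y \<longleftrightarrow> x < y \<or> x = (y :: split_real)"

instance
  by standard (auto simp: less_split_real_def less_eq_split_real_def)

end

lemma split_line_total:
  assumes "x \<in> split_line \<Gamma>" "y \<in> split_line \<Gamma>"
  shows "x \<le> y \<or> y \<le> x"
  using assms by (auto simp: split_line_def less_eq_split_real_def less_split_real_def)

text \<open>
  The order topology intrinsic to \<open>A\<close>: the open rays have their endpoints in \<open>A\<close>, so this
  is not in general the subspace topology of an order topology on the whole type.
\<close>

definition order_topology_on :: "'a::order set \<Rightarrow> 'a topology" where
  "order_topology_on A = topology_generated_by
     ({A} \<union> {{x \<in> A. a < x} | a. a \<in> A} \<union> {{x \<in> A. x < a} | a. a \<in> A})"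

definition split_interval :: "real set \<Rightarrow> real \<Rightarrow> split_real set" where
  "split_interval \<Gamma> l = {x \<in> split_line \<Gamma>. Plus 0 \<le> x \<and> x \<le> Minus l}"

definition split_interval_top :: "real set \<Rightarrow> real \<Rightarrow> split_real topology" where
  "split_interval_top \<Gamma> l = subtopology (order_topology_on (split_line \<Gamma>)) (split_interval \<Gamma> l)"

lemma topspace_split_interval_top: "topspace (split_interval_top \<Gamma> l) = split_interval \<Gamma> l"
  by (auto simp: split_interval_top_def order_topology_on_def topology_generated_by_topspace
      split_interval_def)


section \<open>The partial action\<close>

fun affine_act :: "real \<times> real \<Rightarrow> split_real \<Rightarrow> split_real" where
  "affine_act (c, \<mu>) (Reg t) = Reg (\<mu> * (t + c))"
| "affine_act (c, \<mu>) (Minus a) = Minus (\<mu> * (a + c))"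
| "affine_act (c, \<mu>) (Plus a) = Plus (\<mu> * (a + c))"

lemma affine_act_one: "affine_act \<one>\<^bsub>semidirect \<Gamma> \<Lambda>\<^esub> x = x"
  by (cases x) (auto simp: semidirect_def)

lemma affine_act_mult:
  assumes "subgroup \<Lambda> pos_real_group"
    and "g \<in> carrier (semidirect \<Gamma> \<Lambda>)" "h \<in> carrier (semidirect \<Gamma> \<Lambda>)"
  shows "affine_act (g \<otimes>\<^bsub>semidirect \<Gamma> \<Lambda>\<^esub> h) x = affine_act g (affine_act h x)"
proof -
  have "0 \<notin> \<Lambda>"
    using subgroup.subset[OF assms(1)] by (auto simp: pos_real_group_def)
  then show ?thesis
    using assms(2,3) by (cases x; cases g; cases h) (auto simp: semidirect_def field_simps)
qed

text \<open>
  A partial action is given by a partial map for each group element. For the restriction of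
  a global action to \<open>A\<close>, the map of \<open>g\<close> is defined at those \<open>x \<in> A\<close> with \<open>g x \<in> A\<close>.
\<close>

definition restrict_act :: "'x set \<Rightarrow> ('g \<Rightarrow> 'x \<Rightarrow> 'x) \<Rightarrow> 'g \<Rightarrow> 'x \<rightharpoonup> 'x" where
  "restrict_act A \<alpha> g x = (if x \<in> A \<and> \<alpha> g x \<in> A then Some (\<alpha> g x) else None)"

definition split_partial_act :: "real set \<Rightarrow> real \<Rightarrow> real \<times> real \<Rightarrow> split_real \<rightharpoonup> split_real" where
  "split_partial_act \<Gamma> l = restrict_act (split_interval \<Gamma> l) affine_act"

text \<open>
  On a compact metrizable space the existence of an expansivity constant does not depend on
  the compatible metric; here it is demanded for all of them. Metrizability is included so
  that this quantification is never vacuous.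
\<close>

definition expansive_partial_act ::
    "('g, 'b) monoid_scheme \<Rightarrow> 'x topology \<Rightarrow> ('g \<Rightarrow> 'x \<rightharpoonup> 'x) \<Rightarrow> bool" where
  "expansive_partial_act G X \<theta> \<longleftrightarrow>
     metrizable_space X \<and>
     (\<forall>d. Metric_space (topspace X) d \<and> Metric_space.mtopology (topspace X) d = X \<longrightarrow>
        (\<exists>\<epsilon>>0. \<forall>x\<in>topspace X. \<forall>y\<in>topspace X. x \<noteq> y \<longrightarrow>
           (\<exists>g\<in>carrier G. \<exists>x' y'. \<theta> g x = Some x' \<and> \<theta> g y = Some y' \<and> d x' y' > \<epsilon>)))"

end

(*
  Sending a point x to the cut {a in Gamma. a_+ <= x} identifies [0_+, l_-] with a closed subspace of
  the countable power {0,1}^Gamma, so the interval is compact and metrizable. Fix b in Gamma with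
  0 < b < l and put delta = min b (l - b). Translations suffice: if x < y have projections closer than
  delta, then a point c of Gamma separates them, and translating by b - c keeps both in the interval
  and moves them to opposite sides of b. Pairs at opposite sides of b, or with projections delta
  apart, lie in no common member of a certain open cover, so its Lebesgue number is an expansivity
  constant.
*)
theory Submission imports Defs begin

section \<open>Density and the additive subgroup \<open>\<Gamma>\<close>\<close>

lemma dense_between:
  fixes \<Gamma> :: "real set"
  assumes "closure \<Gamma> = UNIV" "s < t"
  obtains a where "a \<in> \<Gamma>" "s < a" "a < t"
proof -
  have "{s<..<t} \<inter> \<Gamma> \<noteq> {}"
    using open_Int_closure_eq_empty[of "{s<..<t}" \<Gamma>] assms by auto
  then show ?thesis using that by auto
qed

lemma group_add_real_group: "group add_real_group"
  by (rule groupI) (auto simp: add_real_group_def intro: exI[of _ "- _"])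

lemma subgroup_add_real_groupD:
  assumes "subgroup \<Gamma> add_real_group"
  shows "0 \<in> \<Gamma>" and "\<And>a b. a \<in> \<Gamma> \<Longrightarrow> b \<in> \<Gamma> \<Longrightarrow> a - b \<in> \<Gamma>"
proof -
  show "0 \<in> \<Gamma>"
    using subgroup.one_closed[OF assms] by (simp add: add_real_group_def)
  fix a b assume ab: "a \<in> \<Gamma>" "b \<in> \<Gamma>"
  have "inv\<^bsub>add_real_group\<^esub> b = - b"
    by (intro group.inv_equality[OF group_add_real_group]) (auto simp: add_real_group_def)
  then show "a - b \<in> \<Gamma>"
    using subgroup.m_closed[OF assms ab(1) subgroup.m_inv_closed[OF assms ab(2)]]
    by (simp add: add_real_group_def)
qed

section \<open>Points of the split line as cuts\<close>

lemmas split_real_order_defs = less_split_real_def less_eq_split_real_def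

lemma split_real_simps [simp]:
  "Plus a \<le> Reg t \<longleftrightarrow> a < t" "Plus a \<le> Minus b \<longleftrightarrow> a < b" "Plus a \<le> Plus b \<longleftrightarrow> a \<le> b"
  by (auto simp: split_real_order_defs)

text \<open>No point lies strictly between \<open>Minus a\<close> and \<open>Plus a\<close>, and
  \<open>Reg a\<close>, which is incomparable with both, is not on the split line when
  \<open>a\<close> is in \<open>\<Gamma>\<close>. So this ray and those of the next two lemmas are
  all expressed by the single predicate \<open>Plus a \<le> x\<close>, the cut at
  \<open>a\<close>.\<close>

lemma less_Plus_iff:
  assumes "x \<in> split_line \<Gamma>" "a \<in> \<Gamma>"
  shows "x < Plus a \<longleftrightarrow> \<not> Plus a \<le> x"
  using assms by (auto simp: split_line_def split_real_order_defs) (metis linorder_neqE)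

lemma le_Minus_iff:
  assumes "x \<in> split_line \<Gamma>" "a \<in> \<Gamma>"
  shows "x \<le> Minus a \<longleftrightarrow> \<not> Plus a \<le> x"
  using assms by (auto simp: split_line_def split_real_order_defs) (metis linorder_neqE)

lemma Minus_less_iff:
  assumes "x \<in> split_line \<Gamma>" "a \<in> \<Gamma>"
  shows "Minus a < x \<longleftrightarrow> Plus a \<le> x"
  using assms by (auto simp: split_line_def split_real_order_defs)

lemma Plus_le_imp_proj: "Plus a \<le> x \<Longrightarrow> a \<le> proj x"
  by (cases x) auto

lemma not_Plus_le_imp_proj: "\<not> Plus a \<le> x \<Longrightarrow> proj x \<le> a"
  by (cases x) auto

lemma Plus_le_if_proj: "a < proj x \<Longrightarrow> Plus a \<le> x"
  by (cases x) auto

text \<open>If the projections differ, density puts a point of \<open>\<Gamma>\<close> strictly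
  between them. Otherwise the pair is \<open>Minus a\<close>, \<open>Plus a\<close>, and
  \<open>a\<close> itself separates. This translates the order entirely into cuts at points of
  \<open>\<Gamma>\<close>.\<close>

lemma less_iff_cut:
  assumes "closure \<Gamma> = UNIV" "x \<in> split_line \<Gamma>" "y \<in> split_line \<Gamma>"
  shows "x < y \<longleftrightarrow> (\<exists>c\<in>\<Gamma>. \<not> Plus c \<le> x \<and> Plus c \<le> y)"
proof
  assume "x < y"
  then consider "proj x < proj y" | a where "x = Minus a" "y = Plus a"
    by (auto simp: less_split_real_def)
  then show "\<exists>c\<in>\<Gamma>. \<not> Plus c \<le> x \<and> Plus c \<le> y"
  proof cases
    case 1
    then obtain c where "c \<in> \<Gamma>" "proj x < c" "c < proj y"
      using dense_between[OF assms(1)] by metis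
    then show ?thesis
      using Plus_le_imp_proj Plus_le_if_proj by (meson linorder_not_le)
  next
    case 2
    then show ?thesis using assms(3) by (auto simp: split_line_def intro!: bexI[of _ a])
  qed
next
  assume "\<exists>c\<in>\<Gamma>. \<not> Plus c \<le> x \<and> Plus c \<le> y"
  then show "x < y"
    using less_Plus_iff[OF assms(2)] by (meson order_less_le_trans)
qed

lemma split_interval_iff:
  assumes "l \<in> \<Gamma>"
  shows "x \<in> split_interval \<Gamma> l \<longleftrightarrow> x \<in> split_line \<Gamma> \<and> Plus 0 \<le> x \<and> \<not> Plus l \<le> x"
  using le_Minus_iff[OF _ assms] by (auto simp: split_interval_def)

text \<open>The supremum of the points where \<open>h\<close> holds is the projection of the wanted
  point; \<open>u\<close> and \<open>v\<close> make it finite. It provides surjectivity of the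
  passage from points to cuts.\<close>

lemma cut_realised:
  fixes h :: "real \<Rightarrow> bool"
  assumes dense: "closure \<Gamma> = UNIV"
    and down: "\<And>a b. a \<in> \<Gamma> \<Longrightarrow> b \<in> \<Gamma> \<Longrightarrow> a \<le> b \<Longrightarrow> h b \<Longrightarrow> h a"
    and u: "u \<in> \<Gamma>" "h u" and v: "v \<in> \<Gamma>" "\<not> h v"
  obtains x where "x \<in> split_line \<Gamma>" "\<And>a. a \<in> \<Gamma> \<Longrightarrow> Plus a \<le> x \<longleftrightarrow> h a"
proof -
  define D where "D = {a \<in> \<Gamma>. h a}"
  define s where "s = Sup D"
  have "D \<noteq> {}" using u by (auto simp: D_def)
  have "a \<le> v" if "a \<in> D" for a
    using down[of v a] that v by (auto simp: D_def) (meson linear)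
  then have "bdd_above D" by (rule bdd_aboveI)
  have below: "h a" if "a \<in> \<Gamma>" "a < s" for a
    using less_cSup_iff[OF \<open>D \<noteq> {}\<close> \<open>bdd_above D\<close>, of a] that down
    by (auto simp: D_def s_def intro: less_imp_le)
  have above: "\<not> h a" if "a \<in> \<Gamma>" "s < a" for a
    using cSup_upper[OF _ \<open>bdd_above D\<close>, of a] that by (auto simp: D_def s_def)
  \<comment> \<open>Away from \<open>s\<close> the values of \<open>h\<close> are forced. Only
    \<open>h s\<close> remains free, and only if \<open>s\<close> is in \<open>\<Gamma>\<close>,
    which is exactly when there are two points over \<open>s\<close> to choose from.\<close>
  define x where "x = (if s \<notin> \<Gamma> then Reg s else if h s then Plus s else Minus s)"
  have "x \<in> split_line \<Gamma>"
    by (auto simp: x_def split_line_def)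
  moreover have "Plus a \<le> x \<longleftrightarrow> h a" if "a \<in> \<Gamma>" for a
    using below[OF that] above[OF that] that by (cases a s rule: linorder_cases) (auto simp: x_def)
  ultimately show ?thesis using that by blast
qed

section \<open>Topology of the split interval\<close>

text \<open>The two sides of a cut at \<open>a\<close> are the open rays above
  \<open>Minus a\<close> and below \<open>Plus a\<close>. Being complementary, both are clopen in
  the interval.\<close>

lemma openin_split_interval_rays:
  assumes "l \<in> \<Gamma>" "a \<in> \<Gamma>"
  shows "openin (split_interval_top \<Gamma> l) {x \<in> split_interval \<Gamma> l. Plus a \<le> x}"
    and "openin (split_interval_top \<Gamma> l) {x \<in> split_interval \<Gamma> l. \<not> Plus a \<le> x}"
proof -
  have P: "Plus a \<in> split_line \<Gamma>" and M: "Minus a \<in> split_line \<Gamma>"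
    using assms by (auto simp: split_line_def)
  have "openin (order_topology_on (split_line \<Gamma>)) {x \<in> split_line \<Gamma>. Minus a < x}"
    using M unfolding order_topology_on_def by (intro topology_generated_by_Basis) auto
  moreover have "{x \<in> split_interval \<Gamma> l. Plus a \<le> x} =
      {x \<in> split_line \<Gamma>. Minus a < x} \<inter> split_interval \<Gamma> l"
    using Minus_less_iff[OF _ assms(2)] by (auto simp: split_interval_iff[OF assms(1)])
  ultimately show "openin (split_interval_top \<Gamma> l) {x \<in> split_interval \<Gamma> l. Plus a \<le> x}"
    unfolding split_interval_top_def openin_subtopology by blast
  have "openin (order_topology_on (split_line \<Gamma>)) {x \<in> split_line \<Gamma>. x < Plus a}"
    using P unfolding order_topology_on_def by (intro topology_generated_by_Basis) auto
  moreover have "{x \<in> split_interval \<Gamma> l. \<not> Plus a \<le> x} =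
      {x \<in> split_line \<Gamma>. x < Plus a} \<inter> split_interval \<Gamma> l"
    using less_Plus_iff[OF _ assms(2)] by (auto simp: split_interval_iff[OF assms(1)])
  ultimately show "openin (split_interval_top \<Gamma> l) {x \<in> split_interval \<Gamma> l. \<not> Plus a \<le> x}"
    unfolding split_interval_top_def openin_subtopology by blast
qed

section \<open>Cuts as a closed subset of a power of a two-point space\<close>

definition cut_space :: "real set \<Rightarrow> (real \<Rightarrow> bool) topology" where
  "cut_space \<Gamma> = product_topology (\<lambda>_. discrete_topology UNIV) \<Gamma>"

text \<open>These are the indicators of initial segments of \<open>\<Gamma>\<close>; the conditions
  at \<open>0\<close> and \<open>l\<close> encode the endpoints \<open>Plus 0\<close> and
  \<open>Minus l\<close>. Extensionality makes a cut determined by its values on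
  \<open>\<Gamma>\<close>.\<close>

definition interval_cuts :: "real set \<Rightarrow> real \<Rightarrow> (real \<Rightarrow> bool) set" where
  "interval_cuts \<Gamma> l = {h \<in> extensional \<Gamma>.
     (\<forall>a\<in>\<Gamma>. \<forall>b\<in>\<Gamma>. a \<le> b \<longrightarrow> h b \<longrightarrow> h a) \<and> h 0 \<and> \<not> h l}"

lemma topspace_cut_space: "topspace (cut_space \<Gamma>) = extensional \<Gamma>"
  by (auto simp: cut_space_def PiE_def)

lemma cut_space_coordinate:
  assumes "a \<in> \<Gamma>"
  shows "openin (cut_space \<Gamma>) {h \<in> extensional \<Gamma>. h a = p}"
    and "closedin (cut_space \<Gamma>) {h \<in> extensional \<Gamma>. h a = p}"
proof -
  have c: "continuous_map (cut_space \<Gamma>) (discrete_topology UNIV) (\<lambda>h. h a)"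
    unfolding cut_space_def using assms by (rule continuous_map_product_projection)
  show "openin (cut_space \<Gamma>) {h \<in> extensional \<Gamma>. h a = p}"
    using openin_continuous_map_preimage[OF c, of "{p}"] by (simp add: topspace_cut_space)
  show "closedin (cut_space \<Gamma>) {h \<in> extensional \<Gamma>. h a = p}"
    using closedin_continuous_map_preimage[OF c, of "{p}"] by (simp add: topspace_cut_space)
qed

lemma compact_space_cut_space: "compact_space (cut_space \<Gamma>)"
  by (auto simp: cut_space_def compact_space_product_topology compact_space_discrete_topology)

text \<open>Countability of \<open>\<Gamma>\<close> enters here: a countable product of metrizable
  spaces is metrizable.\<close>

lemma metrizable_space_cut_space: "countable \<Gamma> \<Longrightarrow> metrizable_space (cut_space \<Gamma>)"
  unfolding cut_space_def metrizable_space_product_topology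
  by (intro disjI2 conjI ballI metrizable_space_discrete_topology) (rule countable_subset[of _ \<Gamma>], auto)

text \<open>Every defining condition involves at most two coordinates. Monotonicity for a pair
  \<open>a \<le> b\<close> says that \<open>h b\<close> is false or \<open>h a\<close> is true, a
  union of two closed coordinate sets, and all such conditions are intersected.\<close>

lemma closedin_interval_cuts:
  assumes "0 \<in> \<Gamma>" "l \<in> \<Gamma>"
  shows "closedin (cut_space \<Gamma>) (interval_cuts \<Gamma> l)"
proof -
  define E where "E a p = {h \<in> extensional \<Gamma>. h a = p}" for a :: real and p :: bool
  let ?I = "\<Inter>({E 0 True, E l False} \<union> {E b False \<union> E a True | a b. a \<in> \<Gamma> \<and> b \<in> \<Gamma> \<and> a \<le> b})"
  have "closedin (cut_space \<Gamma>) (E a p)" if "a \<in> \<Gamma>" for a p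
    unfolding E_def using that by (rule cut_space_coordinate)
  then have "closedin (cut_space \<Gamma>) ?I"
    using assms by (intro closedin_Inter) (auto intro!: closedin_Un)
  moreover have "?I = interval_cuts \<Gamma> l"
  proof (intro equalityI subsetI)
    fix h assume h: "h \<in> ?I"
    then have "h \<in> E b False \<union> E a True" if "a \<in> \<Gamma>" "b \<in> \<Gamma>" "a \<le> b" for a b
      using that by blast
    then show "h \<in> interval_cuts \<Gamma> l"
      using h by (fastforce simp: interval_cuts_def E_def)
  next
    fix h assume "h \<in> interval_cuts \<Gamma> l"
    then show "h \<in> ?I"
      by (auto simp: interval_cuts_def E_def)
  qed
  ultimately show ?thesis by simp
qed

text \<open>Cuts at \<open>\<Gamma>\<close> separate points, and every admissible cut is realised,
  so the map is bijective. Both topologies are generated by conditions on single cuts, which gives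
  continuity in both directions.\<close>

lemma split_interval_homeomorphic_cuts:
  assumes dense: "closure \<Gamma> = UNIV" and "0 \<in> \<Gamma>" "l \<in> \<Gamma>"
  shows "split_interval_top \<Gamma> l homeomorphic_space subtopology (cut_space \<Gamma>) (interval_cuts \<Gamma> l)"
proof -
  let ?X = "split_interval \<Gamma> l" and ?C = "interval_cuts \<Gamma> l"
  let ?K = "subtopology (cut_space \<Gamma>) (interval_cuts \<Gamma> l)"
  define f where "f x = restrict (\<lambda>a. Plus a \<le> x) \<Gamma>" for x
  define g where "g = inv_into ?X f"
  note X_iff = split_interval_iff[OF assms(3)]
  have X_line: "?X \<subseteq> split_line \<Gamma>" by (auto simp: X_iff)
  have f_app: "f x a \<longleftrightarrow> Plus a \<le> x" if "a \<in> \<Gamma>" for x a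
    using that by (simp add: f_def)
  have inj: "inj_on f ?X"
  proof (rule inj_onI)
    fix x y assume xy: "x \<in> ?X" "y \<in> ?X" "f x = f y"
    then have "Plus c \<le> x \<longleftrightarrow> Plus c \<le> y" if "c \<in> \<Gamma>" for c
      using f_app[OF that, of x] f_app[OF that, of y] by simp
    moreover have "x < y \<or> y < x \<or> x = y"
      using split_line_total[of x \<Gamma> y] xy X_line by (auto simp: order.order_iff_strict)
    ultimately show "x = y"
      using less_iff_cut[OF dense, of x y] less_iff_cut[OF dense, of y x] xy X_line by blast
  qed
  have fX: "f x \<in> ?C" if "x \<in> ?X" for x
    using that assms unfolding X_iff interval_cuts_def
    by (auto simp: f_def intro: order_trans[rotated])
  have surj: "?C \<subseteq> f ` ?X"
  proof
    fix h assume h: "h \<in> ?C"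
    then have down: "h a" if "a \<in> \<Gamma>" "b \<in> \<Gamma>" "a \<le> b" "h b" for a b
      using that by (auto simp: interval_cuts_def)
    have h0: "h 0" and hl: "\<not> h l" using h by (auto simp: interval_cuts_def)
    obtain x where x: "x \<in> split_line \<Gamma>" "\<And>a. a \<in> \<Gamma> \<Longrightarrow> Plus a \<le> x \<longleftrightarrow> h a"
      using cut_realised[OF dense _ assms(2) h0 assms(3) hl] down by blast
    \<comment> \<open>On \<open>\<Gamma>\<close> both functions record the same cut; outside it both
      have the default value \<open>undefined\<close>.\<close>
    moreover have "f x = h"
      using h by (intro extensionalityI[of _ \<Gamma>]) (auto simp: f_app x(2) interval_cuts_def, simp add: f_def)
    ultimately show "h \<in> f ` ?X"
      using h assms by (auto simp: X_iff interval_cuts_def)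
  qed
  have img: "f ` ?X = ?C" using fX surj by blast
  have gC: "g h \<in> ?X" if "h \<in> ?C" for h
    using inv_into_into[of h f ?X] that img by (simp add: g_def)
  have fg: "f (g h) = h" if "h \<in> ?C" for h
    using f_inv_into_f[of h f ?X] that img by (simp add: g_def)
  have g_cut: "Plus a \<le> g h \<longleftrightarrow> h a" if "a \<in> \<Gamma>" "h \<in> ?C" for a h
    using f_app[OF that(1), of "g h"] fg[OF that(2)] by simp
  have topK: "topspace ?K = ?C"
    by (auto simp: topspace_cut_space interval_cuts_def)
  have "continuous_map (split_interval_top \<Gamma> l) ?K f"
    unfolding continuous_map_in_subtopology
  proof
    show "continuous_map (split_interval_top \<Gamma> l) (cut_space \<Gamma>) f"
      unfolding cut_space_def continuous_map_componentwise
    proof (intro conjI ballI)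
      show "f ` topspace (split_interval_top \<Gamma> l) \<subseteq> extensional \<Gamma>"
        by (auto simp: f_def)
      fix a assume a: "a \<in> \<Gamma>"
      \<comment> \<open>Only the membership of \<open>True\<close> and \<open>False\<close> in
        \<open>U\<close> matters, so the preimage is a union of sides of the cut at
        \<open>a\<close>.\<close>
      have "openin (split_interval_top \<Gamma> l) {x \<in> ?X. f x a \<in> U}" for U
      proof -
        have "f x a \<in> U \<longleftrightarrow> (if Plus a \<le> x then True else False) \<in> U" for x
          using f_app[OF a] by simp
        then have "{x \<in> ?X. f x a \<in> U} =
            (if True \<in> U then {x \<in> ?X. Plus a \<le> x} else {}) \<union>
            (if False \<in> U then {x \<in> ?X. \<not> Plus a \<le> x} else {})"
          by (auto split: if_splits)
        then show ?thesis
          using openin_split_interval_rays[OF assms(3) a] by (auto intro: openin_Un)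
      qed
      then show "continuous_map (split_interval_top \<Gamma> l) (discrete_topology UNIV) (\<lambda>x. f x a)"
        by (simp add: continuous_map_def topspace_split_interval_top)
    qed
    show "f \<in> topspace (split_interval_top \<Gamma> l) \<rightarrow> ?C"
      using fX by (auto simp: topspace_split_interval_top)
  qed
  moreover have "continuous_map ?K (split_interval_top \<Gamma> l) g"
    unfolding split_interval_top_def continuous_map_in_subtopology
  proof
    show "g \<in> topspace ?K \<rightarrow> ?X" using gC topK by auto
    \<comment> \<open>By \<open>less_iff_cut\<close>, the preimage under \<open>g\<close> of an open
      ray asks for some cut point, from a set depending on the end of the ray, at which
      \<open>h\<close> has a prescribed value. Such a set is a union of open coordinate
      sets.\<close>
    have op: "openin ?K {h \<in> ?C. \<exists>c\<in>S. h c = p}" if "S \<subseteq> \<Gamma>" for S p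
    proof -
      have "openin (cut_space \<Gamma>) (\<Union>c\<in>S. {h \<in> extensional \<Gamma>. h c = p})"
        using cut_space_coordinate(1) that by (intro openin_Union) auto
      moreover have "{h \<in> ?C. \<exists>c\<in>S. h c = p} =
          (\<Union>c\<in>S. {h \<in> extensional \<Gamma>. h c = p}) \<inter> ?C"
        by (auto simp: interval_cuts_def)
      ultimately show ?thesis unfolding openin_subtopology by blast
    qed
    show "continuous_map ?K (order_topology_on (split_line \<Gamma>)) g"
      unfolding order_topology_on_def
    proof (rule continuous_on_generated_topo)
      fix U
      assume "U \<in> {split_line \<Gamma>} \<union> {{x \<in> split_line \<Gamma>. a < x} |a. a \<in> split_line \<Gamma>} \<union>
        {{x \<in> split_line \<Gamma>. x < a} |a. a \<in> split_line \<Gamma>}"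
      then consider "U = split_line \<Gamma>"
        | a where "a \<in> split_line \<Gamma>" "U = {x \<in> split_line \<Gamma>. a < x}"
        | a where "a \<in> split_line \<Gamma>" "U = {x \<in> split_line \<Gamma>. x < a}"
        by auto
      then show "openin ?K (g -` U \<inter> topspace ?K)"
      proof cases
        case 1
        then have "g -` U \<inter> topspace ?K = topspace ?K"
          using gC X_line topK by auto
        then show ?thesis by (metis openin_topspace)
      next
        case 2
        have "a < g h \<longleftrightarrow> (\<exists>c\<in>{c \<in> \<Gamma>. \<not> Plus c \<le> a}. h c = True)" if "h \<in> ?C" for h
          using less_iff_cut[OF dense 2(1), of "g h"] gC[OF that] X_line g_cut[OF _ that] by auto
        then have "g -` U \<inter> topspace ?K = {h \<in> ?C. \<exists>c\<in>{c \<in> \<Gamma>. \<not> Plus c \<le> a}. h c = True}"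
          unfolding topK 2(2) using gC X_line by blast
        then show ?thesis using op[of "{c \<in> \<Gamma>. \<not> Plus c \<le> a}" True] by simp
      next
        case 3
        have "g h < a \<longleftrightarrow> (\<exists>c\<in>{c \<in> \<Gamma>. Plus c \<le> a}. h c = False)" if "h \<in> ?C" for h
          using less_iff_cut[OF dense _ 3(1), of "g h"] gC[OF that] X_line g_cut[OF _ that] by auto
        then have "g -` U \<inter> topspace ?K = {h \<in> ?C. \<exists>c\<in>{c \<in> \<Gamma>. Plus c \<le> a}. h c = False}"
          unfolding topK 3(2) using gC X_line by blast
        then show ?thesis using op[of "{c \<in> \<Gamma>. Plus c \<le> a}" False] by simp
      qed
    next
      show "g ` topspace ?K \<subseteq> \<Union> ({split_line \<Gamma>} \<union>
        {{x \<in> split_line \<Gamma>. a < x} |a. a \<in> split_line \<Gamma>} \<union>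
        {{x \<in> split_line \<Gamma>. x < a} |a. a \<in> split_line \<Gamma>})"
        using gC X_line topK by auto
    qed
  qed
  ultimately have "homeomorphic_maps (split_interval_top \<Gamma> l) ?K f g"
    unfolding homeomorphic_maps_def topK topspace_split_interval_top
    using inj fg by (auto simp: g_def)
  then show ?thesis unfolding homeomorphic_space_def by blast
qed

lemma compact_space_split_interval:
  assumes "closure \<Gamma> = UNIV" "0 \<in> \<Gamma>" "l \<in> \<Gamma>"
  shows "compact_space (split_interval_top \<Gamma> l)"
  using homeomorphic_compact_space[OF split_interval_homeomorphic_cuts[OF assms]]
    closedin_compact_space[OF compact_space_cut_space closedin_interval_cuts[OF assms(2,3)]]
    compact_space_subtopology by blast

lemma metrizable_space_split_interval:
  assumes "closure \<Gamma> = UNIV" "0 \<in> \<Gamma>" "l \<in> \<Gamma>" "countable \<Gamma>"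
  shows "metrizable_space (split_interval_top \<Gamma> l)"
  using homeomorphic_metrizable_space[OF split_interval_homeomorphic_cuts[OF assms(1-3)]]
    metrizable_space_subtopology[OF metrizable_space_cut_space[OF assms(4)]] by blast

section \<open>Expansivity\<close>

text \<open>Points \<open>p\<close> and \<open>q\<close> of \<open>\<Gamma>\<close> within
  \<open>\<delta>/2\<close> on either side of the projection give a short neighbourhood. Replacing
  the end on the far side of \<open>b\<close> by \<open>b\<close> where necessary keeps it on one
  side of the cut at \<open>b\<close>. These neighbourhoods will form the open cover.\<close>

lemma small_split_neighbourhood:
  assumes dense: "closure \<Gamma> = UNIV" and x: "x \<in> split_line \<Gamma>" and b: "b \<in> \<Gamma>" and "\<delta> > 0"
  obtains a c where "a \<in> \<Gamma>" "c \<in> \<Gamma>" "Plus a \<le> x" "\<not> Plus c \<le> x" "c - a < \<delta>" "\<not> (a < b \<and> b < c)"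
proof -
  let ?t = "proj x"
  obtain p where p: "p \<in> \<Gamma>" "?t - \<delta>/2 < p" "p < ?t"
    using dense_between[OF dense, of "?t - \<delta>/2" ?t] \<open>\<delta> > 0\<close> by auto
  obtain q where q: "q \<in> \<Gamma>" "?t < q" "q < ?t + \<delta>/2"
    using dense_between[OF dense, of ?t "?t + \<delta>/2"] \<open>\<delta> > 0\<close> by auto
  have px: "Plus p \<le> x" using Plus_le_if_proj p by blast
  have qx: "\<not> Plus q \<le> x" using Plus_le_imp_proj[of q x] q by linarith
  show ?thesis
  proof (cases "Plus b \<le> x")
    case True
    then show ?thesis
      using that[of "max p b" q] p q px qx b by (auto simp: max_def)
  next
    case False
    then show ?thesis
      using that[of p "min q b"] p q px qx b by (auto simp: min_def)
  qed
qed

section \<open>Translations of the split line\<close>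

lemma Plus_le_translate: "Plus a \<le> affine_act (s, 1) x \<longleftrightarrow> Plus (a - s) \<le> x"
  by (cases x) auto

lemma translate_split_line:
  assumes "subgroup \<Gamma> add_real_group" "s \<in> \<Gamma>" "x \<in> split_line \<Gamma>"
  shows "affine_act (s, 1) x \<in> split_line \<Gamma>"
proof -
  note G = subgroup_add_real_groupD[OF assms(1)]
  have iff: "t + s \<in> \<Gamma> \<longleftrightarrow> t \<in> \<Gamma>" for t
    using G(2)[of "t + s" s] G(2)[of t "- s"] G(2)[OF G(1) assms(2)] assms(2) by auto
  show ?thesis using assms(3) by (auto simp: split_line_def iff)
qed

text \<open>Some cut at \<open>c\<close> separates the points, and translation by
  \<open>b - c\<close> carries it to the cut at \<open>b\<close>. Since \<open>c\<close> lies
  between the projections, a gap smaller than the room on each side of \<open>b\<close> keeps both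
  images in the interval.\<close>

lemma translate_separates:
  assumes sub: "subgroup \<Gamma> add_real_group" and dense: "closure \<Gamma> = UNIV" and l: "l \<in> \<Gamma>"
    and b: "b \<in> \<Gamma>" and x: "x \<in> split_interval \<Gamma> l" and y: "y \<in> split_interval \<Gamma> l"
    and "x < y" and close: "proj y - proj x < b" "proj y - proj x < l - b"
  obtains s where "s \<in> \<Gamma>" "affine_act (s, 1) x \<in> split_interval \<Gamma> l"
    "affine_act (s, 1) y \<in> split_interval \<Gamma> l"
    "\<not> Plus b \<le> affine_act (s, 1) x" "Plus b \<le> affine_act (s, 1) y"
proof -
  note X_iff = split_interval_iff[OF l]
  obtain c where c: "c \<in> \<Gamma>" "\<not> Plus c \<le> x" "Plus c \<le> y"
    using less_iff_cut[OF dense, of x y] x y \<open>x < y\<close> by (auto simp: X_iff)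
  define s where "s = b - c"
  have "s \<in> \<Gamma>" unfolding s_def using subgroup_add_real_groupD(2)[OF sub b c(1)] .
  have "proj x \<le> c" "c \<le> proj y"
    using c not_Plus_le_imp_proj Plus_le_imp_proj by blast+
  \<comment> \<open>Here \<open>c - b \<le> proj y - b < proj x\<close> and
    \<open>proj y < proj x + (l - b) \<le> c + (l - b)\<close>. Strictness decides the cuts at
    \<open>0 - s\<close> and \<open>l - s\<close> whichever point lies over the projection.\<close>
  then have "0 - s < proj x" "proj y < l - s"
    using close by (auto simp: s_def)
  then have x0: "Plus (0 - s) \<le> x" and yl: "\<not> Plus (l - s) \<le> y"
    using Plus_le_if_proj Plus_le_imp_proj by (blast, fastforce)
  have y0: "Plus (0 - s) \<le> y" using x0 \<open>x < y\<close> by (meson order_le_less_trans less_imp_le)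
  have xl: "\<not> Plus (l - s) \<le> x" using yl \<open>x < y\<close> by (meson order_le_less_trans less_imp_le)
  show ?thesis
    by (rule that[OF \<open>s \<in> \<Gamma>\<close>])
      (use x y c x0 y0 xl yl translate_split_line[OF sub \<open>s \<in> \<Gamma>\<close>] in
        \<open>auto simp: X_iff Plus_le_translate s_def\<close>)
qed

section \<open>The expansivity constant from a Lebesgue number\<close>

theorem lemma5p9:
  fixes \<Lambda> \<Gamma> :: "real set" and l :: real
  assumes "subgroup \<Lambda> pos_real_group"
    and "scale_submodule \<Lambda> \<Gamma>"
    and "countable \<Gamma>"
    and "closure \<Gamma> = UNIV"
    and "l \<in> \<Gamma>"
    and "l > 0"
  shows "expansive_partial_act (semidirect \<Gamma> \<Lambda>) (split_interval_top \<Gamma> l) (split_partial_act \<Gamma> l)"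
  unfolding expansive_partial_act_def topspace_split_interval_top
proof (intro conjI allI impI)
  note dense = \<open>closure \<Gamma> = UNIV\<close>
  have sub: "subgroup \<Gamma> add_real_group"
    using assms(2) by (simp add: scale_submodule_def)
  have "0 \<in> \<Gamma>" by (rule subgroup_add_real_groupD(1)[OF sub])
  have "1 \<in> \<Lambda>"
    using subgroup.one_closed[OF assms(1)] by (simp add: pos_real_group_def)
  let ?X = "split_interval \<Gamma> l"
  note X_iff = split_interval_iff[OF \<open>l \<in> \<Gamma>\<close>]
  show "metrizable_space (split_interval_top \<Gamma> l)"
    by (rule metrizable_space_split_interval) fact+
  fix d
  assume d: "Metric_space ?X d \<and> Metric_space.mtopology ?X d = split_interval_top \<Gamma> l"
  interpret Metric_space ?X d using d by blast
  have top: "mtopology = split_interval_top \<Gamma> l" using d by blast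
  obtain b where b: "b \<in> \<Gamma>" "0 < b" "b < l"
    using dense_between[OF dense \<open>l > 0\<close>] by blast
  define \<delta> where "\<delta> = min b (l - b)"
  have "\<delta> > 0" using b by (simp add: \<delta>_def)
  define U where "U a c = {x \<in> ?X. Plus a \<le> x \<and> \<not> Plus c \<le> x}" for a c
  \<comment> \<open>Within a member of \<open>\<C>\<close> projections differ by less than
    \<open>\<delta>\<close>, and all points are on the same side of the cut at
    \<open>b\<close>.\<close>
  define \<C> where "\<C> = {U a c | a c. a \<in> \<Gamma> \<and> c \<in> \<Gamma> \<and> c - a < \<delta> \<and> \<not> (a < b \<and> b < c)}"
  have "compactin mtopology ?X"
    using compact_space_split_interval[OF dense \<open>0 \<in> \<Gamma>\<close> \<open>l \<in> \<Gamma>\<close>]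
    by (simp add: top compact_space_def topspace_split_interval_top)
  moreover have "?X \<subseteq> \<Union>\<C>"
  proof
    fix x assume x: "x \<in> ?X"
    then have "x \<in> split_line \<Gamma>" by (simp add: X_iff)
    then obtain a c where "a \<in> \<Gamma>" "c \<in> \<Gamma>" "Plus a \<le> x" "\<not> Plus c \<le> x" "c - a < \<delta>"
      "\<not> (a < b \<and> b < c)"
      using small_split_neighbourhood[OF dense _ b(1) \<open>\<delta> > 0\<close>] by blast
    with x show "x \<in> \<Union>\<C>" unfolding \<C>_def U_def by blast
  qed
  moreover have "openin mtopology V" if "V \<in> \<C>" for V
  proof -
    obtain a c where "a \<in> \<Gamma>" "c \<in> \<Gamma>" "V = U a c"
      using \<open>V \<in> \<C>\<close> unfolding \<C>_def by blast
    moreover have "U a c = {x \<in> ?X. Plus a \<le> x} \<inter> {x \<in> ?X. \<not> Plus c \<le> x}"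
      by (auto simp: U_def)
    ultimately show ?thesis
      using openin_split_interval_rays[OF \<open>l \<in> \<Gamma>\<close>] top by (auto intro: openin_Int)
  qed
  ultimately obtain e where e: "e > 0" "\<And>x. x \<in> ?X \<Longrightarrow> \<exists>V\<in>\<C>. mball x e \<subseteq> V"
    using lebesgue_number by metis
  \<comment> \<open>Points closer than \<open>e\<close> share a member of \<open>\<C>\<close>. The
    contrapositive is what counts: a gap of at least \<open>\<delta>\<close>, or the cut at
    \<open>b\<close> between the points, forces distance at least \<open>e\<close>.\<close>
  have close: "proj y - proj x < \<delta> \<and> (Plus b \<le> y \<longrightarrow> Plus b \<le> x)"
    if xy: "x \<in> ?X" "y \<in> ?X" "d x y < e" for x y
  proof -
    obtain V where "V \<in> \<C>" "mball x e \<subseteq> V" using e(2) xy(1) by blast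
    then obtain a c where ac: "c - a < \<delta>" "\<not> (a < b \<and> b < c)" "mball x e \<subseteq> U a c"
      unfolding \<C>_def by blast
    have "x \<in> U a c" "y \<in> U a c"
      using ac(3) xy \<open>e > 0\<close> by (auto simp: in_mball subset_iff)
    then have x: "Plus a \<le> x" and y: "\<not> Plus c \<le> y"
      by (auto simp: U_def)
    have "proj y - proj x < \<delta>"
      using Plus_le_imp_proj[OF x] not_Plus_le_imp_proj[OF y] ac(1) by linarith
    moreover have "Plus b \<le> x" if "Plus b \<le> y"
    proof -
      have "b < c" using that y by (meson order_trans split_real_simps(3) linorder_not_le)
      then have "b \<le> a" using ac(2) by linarith
      then show ?thesis using x by (meson order_trans split_real_simps(3))
    qed
    ultimately show ?thesis by blast
  qed
  have main: "\<exists>s\<in>\<Gamma>. affine_act (s, 1) x \<in> ?X \<and> affine_act (s, 1) y \<in> ?X \<and>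
      d (affine_act (s, 1) x) (affine_act (s, 1) y) \<ge> e"
    if xy: "x \<in> ?X" "y \<in> ?X" "x < y" for x y
  proof (cases "proj y - proj x < \<delta>")
    case True
    then obtain s where "s \<in> \<Gamma>" "affine_act (s, 1) x \<in> ?X" "affine_act (s, 1) y \<in> ?X"
      "\<not> Plus b \<le> affine_act (s, 1) x" "Plus b \<le> affine_act (s, 1) y"
      using translate_separates[OF sub dense \<open>l \<in> \<Gamma>\<close> b(1) xy] by (auto simp: \<delta>_def)
    \<comment> \<open>The translates are on opposite sides of the cut at \<open>b\<close>, which
      \<open>close\<close> rules out at distance below \<open>e\<close>.\<close>
    then show ?thesis using close by (meson linorder_not_le)
  next
    case False
    \<comment> \<open>The projections are already \<open>\<delta>\<close> apart, so the identity of
      the group serves.\<close>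
    have "affine_act (0, 1) z = z" for z by (cases z) auto
    then show ?thesis
      using False close[OF xy(1,2)] xy \<open>0 \<in> \<Gamma>\<close> by (intro bexI[of _ 0]) (auto simp flip: not_less)
  qed
  \<comment> \<open>Totality of the order and symmetry of \<open>d\<close> remove the assumption
    \<open>x < y\<close>; halving \<open>e\<close> turns the weak inequality into the strict one
    required.\<close>
  have "\<exists>s\<in>\<Gamma>. affine_act (s, 1) x \<in> ?X \<and> affine_act (s, 1) y \<in> ?X \<and>
      d (affine_act (s, 1) x) (affine_act (s, 1) y) > e / 2"
    if xy: "x \<in> ?X" "y \<in> ?X" "x \<noteq> y" for x y
  proof -
    have "x < y \<or> y < x"
      using split_line_total[of x \<Gamma> y] xy by (auto simp: X_iff order.order_iff_strict)
    then show ?thesis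
      using main[OF xy(1,2)] main[OF xy(2,1)] commute \<open>e > 0\<close> by (smt (verit) field_sum_of_halves)
  qed
  then show "\<exists>\<epsilon>>0. \<forall>x\<in>?X. \<forall>y\<in>?X. x \<noteq> y \<longrightarrow>
      (\<exists>g\<in>carrier (semidirect \<Gamma> \<Lambda>). \<exists>x' y'. split_partial_act \<Gamma> l g x = Some x' \<and>
        split_partial_act \<Gamma> l g y = Some y' \<and> \<epsilon> < d x' y')"
    using \<open>e > 0\<close> \<open>1 \<in> \<Lambda>\<close>
    by (intro exI[of _ "e / 2"])
      (fastforce simp: split_partial_act_def restrict_act_def semidirect_def)
qed

end
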